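(* For any $n\ge1$, $$C_n(-1,q)=\sum_{\pi\in\mathfrak{S}_n(321)}(-1)^{\mathsf{exc}\,\pi}q^{\mathsf{inv}\,\pi-\mathsf{exc}\,\pi}=\begin{cases}0,& n\text{ even},\\ (-q)^{(n-1)/2}C_{(n-1)/2}(q^2),& n\text{ odd},\end{cases}$$ and $$\sum_{\pi\in\mathfrak{D}_n(321)}(-1)^{\mathsf{exc}\,\pi}q^{\mathsf{inv}\,\pi}=\begin{cases}(-q)^{n/2}C_{n/2}(q^2),& n\text{ even},\\ 0,& n\text{ odd}.\end{cases}$$
   Context: $C_n(t,q)$ is defined by $\sum_{n\ge0}C_n(t,q)z^n=1/(1-c_1z/(1-c_2z/(1-c_3z/\cdots)))$ with $c_{2k-1}=q^{k-1}$, $c_{2k}=tq^{k-1}$; Carlitz's $q$-Catalan numbers are $C_n(q):=C_n(q,q^2)$. $\mathfrak{S}_n(321)$: permutations of $[n]$ avoiding $321$; $\mathfrak{D}_n(321)$: those among them with no fixed point. $\mathsf{exc}\,\pi=\#\{i:\pi(i)>i\}$, $\mathsf{inv}\,\pi=\#\{i<j:\pi(i)>\pi(j)\}$. *)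

theory Defs
  imports "HOL-Combinatorics.Permutations" "HOL-Computational_Algebra.Formal_Power_Series"
begin

definition cfcoeff :: "'a::field \<Rightarrow> 'a \<Rightarrow> nat \<Rightarrow> 'a" where
  "cfcoeff t q j = (if odd j then q ^ ((j - 1) div 2) else t * q ^ (j div 2 - 1))"

fun cftrunc :: "'a::field \<Rightarrow> 'a \<Rightarrow> nat \<Rightarrow> nat \<Rightarrow> 'a fps" where
  "cftrunc t q j 0 = 1"
| "cftrunc t q j (Suc d) =
     inverse (1 - fps_const (cfcoeff t q j) * fps_X * cftrunc t q (Suc j) d)"

text \<open>C_n(t,q): coefficient of z^n of the (formal limit of the) continued fraction.\<close>
definition Cn :: "nat \<Rightarrow> 'a::field \<Rightarrow> 'a \<Rightarrow> 'a" where
  "Cn n t q = (THE c. eventually (\<lambda>d. fps_nth (cftrunc t q 1 d) n = c) sequentially)"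

definition carlitzC :: "nat \<Rightarrow> 'a::field \<Rightarrow> 'a" where
  "carlitzC n q = Cn n q (q ^ 2)"

definition avoids321 :: "nat \<Rightarrow> (nat \<Rightarrow> nat) \<Rightarrow> bool" where
  "avoids321 n \<pi> \<longleftrightarrow> \<not> (\<exists>i j k. 1 \<le> i \<and> i < j \<and> j < k \<and> k \<le> n \<and> \<pi> i > \<pi> j \<and> \<pi> j > \<pi> k)"

definition S321 :: "nat \<Rightarrow> (nat \<Rightarrow> nat) set" where
  "S321 n = {\<pi>. \<pi> permutes {1..n} \<and> avoids321 n \<pi>}"

definition D321 :: "nat \<Rightarrow> (nat \<Rightarrow> nat) set" where
  "D321 n = {\<pi>. \<pi> \<in> S321 n \<and> (\<forall>i\<in>{1..n}. \<pi> i \<noteq> i)}"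

definition exc :: "nat \<Rightarrow> (nat \<Rightarrow> nat) \<Rightarrow> nat" where
  "exc n \<pi> = card {i \<in> {1..n}. \<pi> i > i}"

definition inv_count :: "nat \<Rightarrow> (nat \<Rightarrow> nat) \<Rightarrow> nat" where
  "inv_count n \<pi> = card {(i, j). i \<in> {1..n} \<and> j \<in> {1..n} \<and> i < j \<and> \<pi> i > \<pi> j}"

end

theory Submission
  imports Defs "HOL-Library.Infinite_Set"
begin

text \<open>
  A 321-avoiding permutation is increasing on its excedance positions and on the remaining ones,
  hence determined by its sets \<open>X\<close> of excedance positions and \<open>Y\<close> of excedance values; every pair
  with \<open>|X| = |Y|\<close> and \<open>|Y \<inter> [1, i]| \<le> |X \<inter> [1, i)|\<close> occurs. Since \<open>inv \<pi>\<close> is the sum of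
  \<open>\<pi> i - i\<close> over the excedances, reading \<open>i = 1, \<dots>, n\<close> turns the weight \<open>r\<^sup>f\<^sup>i\<^sup>x t\<^sup>e\<^sup>x\<^sup>c q\<^sup>i\<^sup>n\<^sup>v\<^sup>-\<^sup>e\<^sup>x\<^sup>c\<close> into
  that of a Motzkin path, with level weights \<open>r\<close> at height \<open>0\<close> and \<open>q\<^sup>h + t q\<^sup>h\<^sup>-\<^sup>1\<close> at height \<open>h > 0\<close>.
  For \<open>r = 1\<close> the resulting J-fraction is the even contraction of the S-fraction of \<open>C\<^sub>n(t, q)\<close>. For
  \<open>r = 0\<close>, \<open>t = -q\<close> all level weights vanish, as they do in the odd contraction of the S-fraction at
  \<open>t = -1\<close>. In both cases what remains is the series \<open>E\<close> with \<open>E(z) (1 + q z\<^sup>2 E(q z)) = 1\<close>, which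
  is Carlitz's series for \<open>q\<^sup>2\<close> evaluated at \<open>-q z\<^sup>2\<close>.
\<close>

unbundle fps_syntax

section \<open>Rescaling the variable of a power series\<close>

text \<open>The substitution f(a z), given by coefficients so that it is total and needs no
  composition of series.\<close>

definition fps_scale :: "'a::comm_ring_1 \<Rightarrow> 'a fps \<Rightarrow> 'a fps" where
  "fps_scale a f = Abs_fps (\<lambda>n. a ^ n * f $ n)"

lemma fps_scale_nth [simp]: "fps_scale a f $ n = a ^ n * f $ n"
  by (simp add: fps_scale_def)

lemma fps_scale_one [simp]: "fps_scale a 1 = 1"
  by (rule fps_ext) simp

lemma fps_scale_by_one: "fps_scale 1 f = f"
  by (rule fps_ext) simp

lemma fps_scale_X [simp]: "fps_scale a fps_X = fps_const a * fps_X"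
  by (rule fps_ext) (simp add: fps_X_def)

lemma fps_scale_const [simp]: "fps_scale a (fps_const c) = fps_const c"
  by (rule fps_ext) simp

lemma fps_scale_add: "fps_scale a (f + g) = fps_scale a f + fps_scale a g"
  by (rule fps_ext) (simp add: algebra_simps)

lemma fps_scale_diff: "fps_scale a (f - g) = fps_scale a f - fps_scale a g"
  by (rule fps_ext) (simp add: algebra_simps)

lemma fps_scale_mult: "fps_scale a (f * g) = fps_scale a f * fps_scale a g"
proof (rule fps_ext)
  fix n
  have "a ^ n * (f $ i * g $ (n - i)) = (a ^ i * f $ i) * (a ^ (n - i) * g $ (n - i))"
    if "i \<le> n" for i
  proof -
    have "a ^ n = a ^ i * a ^ (n - i)" using that by (simp flip: power_add)
    then show ?thesis by (simp add: algebra_simps)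
  qed
  then show "fps_scale a (f * g) $ n = (fps_scale a f * fps_scale a g) $ n"
    by (simp add: fps_mult_nth sum_distrib_left)
qed

lemma fps_scale_scale: "fps_scale a (fps_scale b f) = fps_scale (a * b) f"
  by (rule fps_ext) (simp add: algebra_simps)

lemmas fps_scale_hom = fps_scale_add fps_scale_diff fps_scale_mult

section \<open>The limit of the continued fraction\<close>

lemma cftrunc_nth_0 [simp]: "cftrunc t q j d $ 0 = 1"
  by (cases d) auto

lemma cftrunc_Suc_eq:
  "cftrunc t q j (Suc d) =
     1 + fps_const (cfcoeff t q j) * fps_X * (cftrunc t q j (Suc d) * cftrunc t q (Suc j) d)"
proof -
  let ?g = "1 - fps_const (cfcoeff t q j) * fps_X * cftrunc t q (Suc j) d"
  have "?g $ 0 \<noteq> 0" by simp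
  then have "inverse ?g * ?g = 1" by (rule inverse_mult_eq_1)
  then show ?thesis by (simp add: algebra_simps)
qed

lemma cftrunc_Suc_nth_Suc:
  "cftrunc t q j (Suc d) $ Suc n =
     cfcoeff t q j * (\<Sum>i\<le>n. cftrunc t q j (Suc d) $ i * cftrunc t q (Suc j) d $ (n - i))"
  by (subst cftrunc_Suc_eq)
     (simp add: mult.assoc fps_mult_nth[of "cftrunc t q j (Suc d)"] atLeast0AtMost del: cftrunc.simps)

text \<open>Coefficient n + 1 at depth d + 1 is a convolution of coefficients of index at most n at
  depths d + 1 and d, so depth n already settles coefficient n. The starting index \<open>j\<close>
  varies because the convolution also involves the next tail.\<close>

lemma cftrunc_nth_stable: "n \<le> d \<Longrightarrow> cftrunc t q j d $ n = cftrunc t q j n $ n"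
proof (induction n arbitrary: d j rule: less_induct)
  case (less n)
  show ?case
  proof (cases n)
    case 0
    then show ?thesis by simp
  next
    case (Suc m)
    with less.prems obtain e where d: "d = Suc e" "m \<le> e" by (cases d) auto
    have 1: "cftrunc t q j (Suc e) $ i = cftrunc t q j (Suc m) $ i" if "i \<le> m" for i
      using less.IH[of i "Suc e" j] less.IH[of i "Suc m" j] that d Suc by simp
    have 2: "cftrunc t q (Suc j) e $ (m - i) = cftrunc t q (Suc j) m $ (m - i)" if "i \<le> m" for i
      using less.IH[of "m - i" e "Suc j"] less.IH[of "m - i" m "Suc j"] that d Suc by simp
    show ?thesis unfolding d Suc cftrunc_Suc_nth_Suc
      by (intro arg_cong2[where f = "(*)"] sum.cong refl) (simp_all add: 1 2 del: cftrunc.simps)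
  qed
qed

text \<open>The formal limit of the tail starting at c_j: coefficient n is read at depth n, beyond
  which it no longer changes.\<close>

definition cflim :: "'a::field \<Rightarrow> 'a \<Rightarrow> nat \<Rightarrow> 'a fps" where
  "cflim t q j = Abs_fps (\<lambda>n. cftrunc t q j n $ n)"

lemma cflim_nth: "n \<le> d \<Longrightarrow> cflim t q j $ n = cftrunc t q j d $ n"
  by (simp add: cflim_def cftrunc_nth_stable[of n d])

lemma Cn_eq_cflim: "Cn n t q = cflim t q 1 $ n"
  unfolding Cn_def
proof (rule the_equality)
  show *: "\<forall>\<^sub>F d in sequentially. cftrunc t q 1 d $ n = cflim t q 1 $ n"
    using eventually_ge_at_top[of n] by eventually_elim (simp add: cflim_nth)
  fix c
  assume "\<forall>\<^sub>F d in sequentially. cftrunc t q 1 d $ n = c"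
  with * have "\<forall>\<^sub>F d in sequentially. c = cflim t q 1 $ n"
    by eventually_elim simp
  then show "c = cflim t q 1 $ n" by simp
qed

lemma cflim_eq:
  "cflim t q j = 1 + fps_const (cfcoeff t q j) * fps_X * (cflim t q j * cflim t q (Suc j))"
proof (rule fps_ext)
  fix n
  show "cflim t q j $ n =
    (1 + fps_const (cfcoeff t q j) * fps_X * (cflim t q j * cflim t q (Suc j))) $ n"
  proof (cases n)
    case 0
    then show ?thesis by (simp add: cflim_def)
  next
    case (Suc m)
    have "cflim t q j $ n = cftrunc t q j (Suc m) $ Suc m"
      by (simp add: Suc cflim_def)
    also have "\<dots> = cfcoeff t q j * (\<Sum>i\<le>m. cflim t q j $ i * cflim t q (Suc j) $ (m - i))"
      unfolding cftrunc_Suc_nth_Suc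
      by (intro arg_cong2[where f = "(*)"] sum.cong refl)
         (simp_all add: cflim_nth[of _ "Suc m" _ _ j] cflim_nth[of _ m _ _ "Suc j"]
           del: cftrunc.simps)
    finally show ?thesis
      by (simp add: Suc mult.assoc fps_mult_nth[of "cflim t q j"] atLeast0AtMost)
  qed
qed

text \<open>Each coefficient c_i comes with one factor z, so multiplying all of them by
  \<open>a\<close> is the same as replacing z by a z. This expresses later tails of the fraction
  through earlier ones.\<close>

lemma cftrunc_shift:
  assumes "\<And>i. i \<ge> j \<Longrightarrow> cfcoeff t q (i + k) = a * cfcoeff t q i"
  shows "cftrunc t q (j + k) d = fps_scale a (cftrunc t q j d)"
  using assms
proof (induction d arbitrary: j)
  case 0
  then show ?case by simp
next
  case (Suc d)
  let ?g = "1 - fps_const (cfcoeff t q j) * fps_X * cftrunc t q (Suc j) d"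
  let ?h = "1 - fps_const (cfcoeff t q (j + k)) * fps_X * cftrunc t q (Suc (j + k)) d"
  have IH: "cftrunc t q (Suc (j + k)) d = fps_scale a (cftrunc t q (Suc j) d)"
    using Suc.IH[of "Suc j"] Suc.prems by simp
  have h: "?h = fps_scale a ?g"
    by (simp add: IH Suc.prems fps_scale_hom algebra_simps flip: fps_const_mult)
  have "inverse ?g * ?g = 1" by (rule inverse_mult_eq_1) simp
  then have "fps_scale a (inverse ?g) * ?h = 1"
    unfolding h by (metis fps_scale_mult fps_scale_one)
  then have "inverse ?h = fps_scale a (inverse ?g)"
    by (metis fps_inverse_unique mult.commute)
  then show ?case by simp
qed

lemma cflim_shift:
  assumes "\<And>i. i \<ge> j \<Longrightarrow> cfcoeff t q (i + k) = a * cfcoeff t q i"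
  shows "cflim t q (j + k) = fps_scale a (cflim t q j)"
  by (rule fps_ext) (simp add: cflim_def cftrunc_shift[OF assms])

section \<open>Functional equations: Carlitz's fraction and the fraction at t = -1\<close>

lemma cfcoeff_1: "cfcoeff t q (Suc 0) = 1" and cfcoeff_2: "cfcoeff t q (Suc (Suc 0)) = t"
  by (simp_all add: cfcoeff_def)

lemma cfcoeff_add_2: "i \<ge> 1 \<Longrightarrow> cfcoeff t q (i + 2) = q * cfcoeff t q i"
  by (cases "odd i") (auto simp: cfcoeff_def elim!: oddE evenE simp flip: power_Suc)

text \<open>At parameters (q, q^2) the odd coefficients are the even powers of q and the even
  coefficients the odd powers, so they interleave to 1, q, q^2, and so on.\<close>

lemma cfcoeff_carlitz: "cfcoeff q (q ^ 2) (Suc i) = q ^ i"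
  by (cases "even i") (auto simp: cfcoeff_def elim!: evenE oddE simp flip: power_mult)

lemma cflim_3: "cflim t q 3 = fps_scale q (cflim t q 1)"
  using cflim_shift[of 1 t q 2 q] cfcoeff_add_2[of _ t q] by (simp add: numeral_3_eq_3)

text \<open>With coefficients 1, q, q^2, ... the tail from c_2 is the whole fraction with z replaced
  by q z.\<close>

lemma carlitz_functional_eq:
  "cflim q (q ^ 2) 1 * (1 - fps_X * fps_scale q (cflim q (q ^ 2) 1)) = 1"
proof -
  have "cflim q (q ^ 2) (1 + 1) = fps_scale q (cflim q (q ^ 2) 1)"
  proof (rule cflim_shift)
    fix i :: nat assume "i \<ge> 1"
    then obtain k where "i = Suc k" by (cases i) auto
    then show "cfcoeff q (q ^ 2) (i + 1) = q * cfcoeff q (q ^ 2) i" 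
      using cfcoeff_carlitz[of q k] cfcoeff_carlitz[of q "Suc k"] by simp
  qed
  then show ?thesis using cflim_eq[of q "q ^ 2" 1] 
    by (simp add: cfcoeff_1 algebra_simps)
qed

text \<open>The series E: Carlitz's generating function in base q^2, evaluated at -q z^2.\<close>

definition carlitz_even_fps :: "'a::field \<Rightarrow> 'a fps" where
  "carlitz_even_fps q =
     Abs_fps (\<lambda>n. if even n then (- q) ^ (n div 2) * carlitzC (n div 2) (q ^ 2) else 0)"

text \<open>Substitute -q z^2 into Carlitz's equation in base q^2. Replacing z by q z multiplies -q
  z^2 by q^2, which is exactly the scaling in that equation.\<close>

lemma carlitz_even_functional_eq:
  fixes q :: "'a::field"
  defines "E \<equiv> carlitz_even_fps q"
  shows "E * (1 + fps_const q * fps_X ^ 2 * fps_scale q E) = 1"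
proof -
  let ?K = "cflim (q ^ 2) ((q ^ 2) ^ 2) 1"
  let ?c = "fps_const (- q) * fps_X ^ 2 :: 'a fps"
  have nth: "(f oo ?c) $ n = (if even n then (- q) ^ (n div 2) * f $ (n div 2) else 0)" for f n
  proof -
    have "(f oo ?c) $ n = (\<Sum>i=0..n. f $ i * ((- q) ^ i * (if n = 2 * i then 1 else 0)))"
      by (simp add: fps_compose_nth power_mult_distrib
           flip: power_mult)
    also have "\<dots> = (\<Sum>i=0..n. if i = n div 2 then (if even n then (- q) ^ i * f $ i else 0) else 0)"
      by (rule sum.cong) auto
    also have "\<dots> = (if even n then (- q) ^ (n div 2) * f $ (n div 2) else 0)"
      by (subst sum.delta) auto
    finally show ?thesis .
  qed
  have c0: "?c $ 0 = 0" by simp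
  have E: "E = ?K oo ?c"
    by (rule fps_ext) (simp add: E_def carlitz_even_fps_def nth carlitzC_def Cn_eq_cflim)
  have Eq: "fps_scale q E = fps_scale (q ^ 2) ?K oo ?c"
    by (rule fps_ext) (auto simp: E nth elim!: evenE simp flip: power_mult)
  have "(?K * (1 - fps_X * fps_scale (q ^ 2) ?K)) oo ?c = 1"
    by (simp only: carlitz_functional_eq fps_compose_1)
  then have "E * (1 - ?c * fps_scale q E) = 1"
    by (simp only: fps_compose_mult_distrib[OF c0] fps_compose_sub_distrib
      fps_X_fps_compose_startby0[OF c0] fps_compose_1 E[symmetric] Eq[symmetric])
  then show ?thesis by (simp flip: fps_const_neg)
qed

text \<open>Because of the factor z^2 the equation is a recurrence: the first two coefficients are 1
  and 0, and coefficient n depends only on those of index at most n - 2.\<close>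

lemma fps_functional_eq_unique:
  fixes f g :: "'a::comm_ring_1 fps"
  assumes f: "f * (1 + fps_const c * fps_X ^ 2 * fps_scale q f) = 1"
    and g: "g * (1 + fps_const c * fps_X ^ 2 * fps_scale q g) = 1"
  shows "f = g"
proof (rule fps_ext)
  have rec: "h $ n = (if n = 0 then 1 else if n = 1 then 0 else
     - c * (\<Sum>i\<le>n - 2. (h $ i) * (q ^ (n - 2 - i) * h $ (n - 2 - i))))"
    if "h * (1 + fps_const c * fps_X ^ 2 * fps_scale q h) = 1" for h :: "'a fps" and n
  proof -
    have h: "h = 1 - fps_const c * (fps_X ^ 2 * (h * fps_scale q h))"
      using that by (simp add: algebra_simps)
    show ?thesis
      by (subst h) (auto simp: fps_X_power_mult_nth fps_mult_nth[of h] atLeast0AtMost)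
  qed
  fix n
  show "f $ n = g $ n"
  proof (induction n rule: less_induct)
    case (less n)
    show ?case
    proof (cases "n < 2")
      case True
      then show ?thesis using rec[OF f, of n] rec[OF g, of n] by (auto simp: less_2_cases_iff)
    next
      case False
      then have "f $ i = g $ i" "f $ (n - 2 - i) = g $ (n - 2 - i)" if "i \<le> n - 2" for i
        using less that by auto
      then show ?thesis using False rec[OF f, of n] rec[OF g, of n] by simp
    qed
  qed
qed

text \<open>
  The odd contraction: the coefficients \<open>c\<^sub>2\<^sub>k\<^sub>-\<^sub>1 + c\<^sub>2\<^sub>k\<close> vanish at \<open>t = -1\<close>, so only even powers of
  \<open>z\<close> survive in \<open>(F - 1) / z\<close>.
\<close>

lemma cflim_minus_one:
  "cflim (-1) q 1 = 1 + fps_X * carlitz_even_fps q"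
proof -
  let ?F = "cflim (-1) q 1" and ?G = "cflim (-1) q 2"
  have F: "?F = 1 + fps_X * (?F * ?G)"
    using cflim_eq[of "-1" q 1] by (simp add: cfcoeff_1 numeral_2_eq_2)
  have G: "?G = 1 - fps_X * (?G * fps_scale q ?F)"
    using cflim_eq[of "-1" q 2] cflim_3[of "-1" q]
    by (simp add: cfcoeff_2 numeral_2_eq_2 numeral_3_eq_3 flip: fps_const_neg)
  have Fq: "fps_scale q ?F = 1 + fps_const q * fps_X * fps_scale q (?F * ?G)"
    by (subst F) (simp add: fps_scale_add fps_scale_mult mult.assoc)
  \<comment> \<open>With P = F G, q z^2 P(q z) = z (F(q z) - 1). Now P (1 + z F(q z)) = F by the
    equation for G, and F - z P = 1 by the one for F.\<close>
  have "(?F * ?G) * (1 + fps_const q * fps_X ^ 2 * fps_scale q (?F * ?G)) = 1"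
    using F G Fq by algebra
  then have "?F * ?G = carlitz_even_fps q"
    using fps_functional_eq_unique carlitz_even_functional_eq by blast
  with F show ?thesis by simp
qed

section \<open>Pairs of excedance positions and excedance values\<close>

text \<open>
  \<open>X\<close> and \<open>Y\<close> stand for the excedance positions and excedance values among \<open>1, \<dots>, n\<close> of a larger
  permutation, so that \<open>h\<close> excedances opened at a position \<open>\<le> n\<close> still await a value \<open>> n\<close>.
\<close>

definition exc_pairs :: "nat \<Rightarrow> nat \<Rightarrow> (nat set \<times> nat set) set" where
  "exc_pairs n h = {(X, Y). X \<subseteq> {1..n} \<and> Y \<subseteq> {1..n} \<and>
     (\<forall>i\<in>{1..n}. card (Y \<inter> {..i}) \<le> card (X \<inter> {..<i})) \<and> card X = card Y + h}"

text \<open>The fixed points of the corresponding permutation: positions and values outside the pair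
  are matched in increasing order, and equal counts below \<open>i\<close> give \<open>i\<close> the
  same rank among both.\<close>

definition pair_fix :: "nat \<Rightarrow> nat set \<Rightarrow> nat set \<Rightarrow> nat set" where
  "pair_fix n X Y = {i \<in> {1..n}. i \<notin> X \<and> i \<notin> Y \<and> card (X \<inter> {..<i}) = card (Y \<inter> {..<i})}"

text \<open>
  The \<open>i\<close>-th summand is the number of excedances \<open>x\<close> with \<open>x < i < \<pi> x\<close>; on \<^const>\<open>exc_pairs\<close> the
  subtraction never truncates.
\<close>

definition pair_gap :: "nat \<Rightarrow> nat set \<Rightarrow> nat set \<Rightarrow> nat" where
  "pair_gap n X Y = (\<Sum>i = 1..n. card (X \<inter> {..<i}) - card (Y \<inter> {..i}))"

text \<open>An excedance is charged its factor \<open>t\<close> at its value, not at its position,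
  so open excedances have not contributed a \<open>t\<close> yet.\<close>

definition pair_weight :: "'a::comm_ring_1 \<Rightarrow> 'a \<Rightarrow> 'a \<Rightarrow> nat \<Rightarrow> nat set \<times> nat set \<Rightarrow> 'a" where
  "pair_weight r t q n =
     (\<lambda>(X, Y). r ^ card (pair_fix n X Y) * t ^ card Y * q ^ pair_gap n X Y)"

definition pair_sum :: "'a::comm_ring_1 \<Rightarrow> 'a \<Rightarrow> 'a \<Rightarrow> nat \<Rightarrow> nat \<Rightarrow> 'a" where
  "pair_sum r t q n h = sum (pair_weight r t q n) (exc_pairs n h)"

text \<open>One step of the Motzkin path: up if only \<open>x\<close> holds, down if only
  \<open>y\<close> holds, level otherwise.\<close>

definition pair_extend :: "nat \<Rightarrow> bool \<Rightarrow> bool \<Rightarrow> nat set \<times> nat set \<Rightarrow> nat set \<times> nat set" where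
  "pair_extend n x y =
     (\<lambda>(X, Y). (if x then insert (Suc n) X else X, if y then insert (Suc n) Y else Y))"

section \<open>The recurrence for the weighted sums\<close>

lemma extend_cut:
  assumes "X \<subseteq> {1..n}"
  shows "i \<le> Suc n \<Longrightarrow> (if x then insert (Suc n) X else X) \<inter> {..<i} = X \<inter> {..<i}"
    and "i \<le> n \<Longrightarrow> (if x then insert (Suc n) X else X) \<inter> {..i} = X \<inter> {..i}"
    and "X \<inter> {..<Suc n} = X"
    and "(if x then insert (Suc n) X else X) \<inter> {..Suc n} = (if x then insert (Suc n) X else X)"
    and "card (if x then insert (Suc n) X else X) = card X + of_bool x"
    and "Suc n \<notin> X"
proof -
  have "finite X" using assms finite_subset by blast
  moreover show "Suc n \<notin> X" using assms by force
  ultimately show "card (if x then insert (Suc n) X else X) = card X + of_bool x" by simp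
qed (use assms in \<open>auto simp: subset_iff less_Suc_eq_le\<close>)

text \<open>Only the inequality at \<open>Suc n\<close> is new. It does not see whether
  \<open>Suc n\<close> joins \<open>X\<close>, since a value must close an excedance opened strictly
  earlier.\<close>

lemma pair_extend_mem_iff:
  assumes "X \<subseteq> {1..n}" "Y \<subseteq> {1..n}"
  shows "pair_extend n x y (X, Y) \<in> exc_pairs (Suc n) h \<longleftrightarrow>
    (\<forall>i\<in>{1..n}. card (Y \<inter> {..i}) \<le> card (X \<inter> {..<i})) \<and>
    card Y + of_bool y \<le> card X \<and> card X + of_bool x = card Y + of_bool y + h"
proof -
  define X' where "X' = (if x then insert (Suc n) X else X)"
  define Y' where "Y' = (if y then insert (Suc n) Y else Y)"
  note X' = extend_cut(1,5)[OF assms(1), where x = x, folded X'_def] extend_cut(3)[OF assms(1)]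
  note Y' = extend_cut(2,4,5)[OF assms(2), where x = y, folded Y'_def]
  have sub: "X' \<subseteq> {1..Suc n}" "Y' \<subseteq> {1..Suc n}"
    using assms by (auto simp: X'_def Y'_def)
  have "(\<forall>i\<in>{1..Suc n}. card (Y' \<inter> {..i}) \<le> card (X' \<inter> {..<i})) \<longleftrightarrow>
      (\<forall>i\<in>{1..n}. card (Y' \<inter> {..i}) \<le> card (X' \<inter> {..<i})) \<and>
      card (Y' \<inter> {..Suc n}) \<le> card (X' \<inter> {..<Suc n})"
    by (auto simp: le_Suc_eq)
  also have "\<dots> \<longleftrightarrow> (\<forall>i\<in>{1..n}. card (Y \<inter> {..i}) \<le> card (X \<inter> {..<i})) \<and>
      card Y + of_bool y \<le> card X"
    using X'(1)[of "Suc n"] by (simp add: X'(1,3) Y')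
  finally show ?thesis
    using sub by (simp add: exc_pairs_def pair_extend_def X'(2) Y'(3) flip: X'_def Y'_def)
qed

text \<open>Of the \<open>k\<close> open excedances one closes at \<open>Suc n\<close> if
  \<open>y\<close> holds; the others pass over \<open>Suc n\<close> and contribute a factor
  \<open>q\<close> each.\<close>

lemma pair_weight_extend:
  assumes "(X, Y) \<in> exc_pairs n k"
  shows "pair_weight r t q (Suc n) (pair_extend n x y (X, Y)) =
    (if \<not> x \<and> \<not> y \<and> k = 0 then r else 1) * t ^ of_bool y * q ^ (k - of_bool y) *
      pair_weight r t q n (X, Y)"
proof -
  have sub: "X \<subseteq> {1..n}" "Y \<subseteq> {1..n}" and k: "card X = card Y + k"
    using assms by (auto simp: exc_pairs_def)
  define X' where "X' = (if x then insert (Suc n) X else X)"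
  define Y' where "Y' = (if y then insert (Suc n) Y else Y)"
  note X' = extend_cut(1)[OF sub(1), where x = x, folded X'_def] extend_cut(3,6)[OF sub(1)]
  note Y' = extend_cut(2,4,5)[OF sub(2), where x = y, folded Y'_def] extend_cut(3,6)[OF sub(2)]
    extend_cut(1)[OF sub(2), where x = y, folded Y'_def]
  have mem: "i \<in> X' \<longleftrightarrow> i \<in> X" "i \<in> Y' \<longleftrightarrow> i \<in> Y" if "i \<le> n" for i
    using that by (auto simp: X'_def Y'_def)
  have memS: "Suc n \<in> X' \<longleftrightarrow> x" "Suc n \<in> Y' \<longleftrightarrow> y"
    using X'(3) Y'(5) by (simp_all add: X'_def Y'_def)
  have "pair_fix (Suc n) X' Y' =
      (if \<not> x \<and> \<not> y \<and> k = 0 then insert (Suc n) (pair_fix n X Y) else pair_fix n X Y)"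
  proof -
    have 1: "i \<in> pair_fix (Suc n) X' Y' \<longleftrightarrow> i \<in> pair_fix n X Y" if "i \<noteq> Suc n" for i
      using that by (cases "i \<le> n") (simp_all add: pair_fix_def X'(1) Y'(6) mem)
    have 2: "Suc n \<in> pair_fix (Suc n) X' Y' \<longleftrightarrow> \<not> x \<and> \<not> y \<and> k = 0"
      using X'(1)[of "Suc n"] Y'(6)[of "Suc n"] by (simp add: pair_fix_def X'(2) Y'(4) memS k)
    have 3: "Suc n \<notin> pair_fix n X Y" by (simp add: pair_fix_def)
    show ?thesis
    proof (rule set_eqI)
      fix i
      show "i \<in> pair_fix (Suc n) X' Y' \<longleftrightarrow> i \<in>
          (if \<not> x \<and> \<not> y \<and> k = 0 then insert (Suc n) (pair_fix n X Y) else pair_fix n X Y)"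
        by (cases "i = Suc n") (simp_all add: 1 2 3)
    qed
  qed
  moreover have "finite (pair_fix n X Y)" "Suc n \<notin> pair_fix n X Y"
    by (auto simp: pair_fix_def)
  ultimately have fixed: "r ^ card (pair_fix (Suc n) X' Y') =
      (if \<not> x \<and> \<not> y \<and> k = 0 then r else 1) * r ^ card (pair_fix n X Y)"
    by simp
  have gap: "pair_gap (Suc n) X' Y' = pair_gap n X Y + (k - of_bool y)"
    using X'(1)[of "Suc n"] X'(2) Y'(2,3) k by (simp add: pair_gap_def X'(1) Y'(1))
  have "pair_extend n x y (X, Y) = (X', Y')" by (simp add: pair_extend_def X'_def Y'_def)
  then show ?thesis
    by (simp only: pair_weight_def prod.case fixed gap Y'(3) power_add mult.assoc mult.commute
      mult.left_commute)
qed

text \<open>Membership of n + 1 in the two sets determines the last step, and removing n + 1 undoes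
  it. If n + 1 is an excedance position, that excedance is still open at the end, which forces
  \<open>h\<close> to be positive.\<close>

lemma sum_exc_pairs_Suc:
  fixes f :: "nat set \<times> nat set \<Rightarrow> 'a::comm_ring_1"
  shows "sum f (exc_pairs (Suc n) h) =
    (\<Sum>p\<in>exc_pairs n h. f (pair_extend n False False p)) +
    (\<Sum>p\<in>exc_pairs n (Suc h). f (pair_extend n False True p)) +
    (if h = 0 then 0 else
      (\<Sum>p\<in>exc_pairs n h. f (pair_extend n True True p)) +
      (\<Sum>p\<in>exc_pairs n (h - 1). f (pair_extend n True False p)))"
proof -
  define Q where "Q x y =
    {p \<in> Pow {1..n} \<times> Pow {1..n}. pair_extend n x y p \<in> exc_pairs (Suc n) h}" for x y
  have Q_iff: "(X, Y) \<in> Q x y \<longleftrightarrow> X \<subseteq> {1..n} \<and> Y \<subseteq> {1..n} \<and>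
      (\<forall>i\<in>{1..n}. card (Y \<inter> {..i}) \<le> card (X \<inter> {..<i})) \<and>
      card Y + of_bool y \<le> card X \<and> card X + of_bool x = card Y + of_bool y + h" for x y X Y
    by (auto simp: Q_def pair_extend_mem_iff)
  have exc_iff: "(X, Y) \<in> exc_pairs n k \<longleftrightarrow> X \<subseteq> {1..n} \<and> Y \<subseteq> {1..n} \<and>
      (\<forall>i\<in>{1..n}. card (Y \<inter> {..i}) \<le> card (X \<inter> {..<i})) \<and> card X = card Y + k" for X Y k
    by (simp add: exc_pairs_def)
  have fin: "finite (Q x y)" for x y by (simp add: Q_def)
  have "sum f (exc_pairs (Suc n) h) =
      (\<Sum>(s, p)\<in>Sigma UNIV (\<lambda>s. Q (fst s) (snd s)). f (pair_extend n (fst s) (snd s) p))"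
  proof (rule sum.reindex_bij_witness[where
      i = "\<lambda>(s, p). pair_extend n (fst s) (snd s) p" and
      j = "\<lambda>(X, Y). ((Suc n \<in> X, Suc n \<in> Y), (X - {Suc n}, Y - {Suc n}))"], goal_cases)
    case (1 a)
    then show ?case by (auto simp: pair_extend_def split: prod.splits)
  next
    case (2 a)
    then obtain X Y where a: "a = (X, Y)" and XY: "(X, Y) \<in> exc_pairs (Suc n) h" by (cases a) auto
    have "(X - {Suc n}, Y - {Suc n}) \<in> Pow {1..n} \<times> Pow {1..n}"
      using XY by (auto simp: exc_pairs_def le_Suc_eq)
    moreover have "pair_extend n (Suc n \<in> X) (Suc n \<in> Y) (X - {Suc n}, Y - {Suc n}) = (X, Y)"
      by (auto simp: pair_extend_def)
    ultimately show ?case using XY by (auto simp: Q_def a)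
  next
    case (3 b)
    then obtain x y X Y where "b = ((x, y), (X, Y))" "X \<subseteq> {1..n}" "Y \<subseteq> {1..n}"
      by (auto simp: Q_def)
    then show ?case using extend_cut(6) by (auto simp: pair_extend_def)
  next
    case (4 b)
    then show ?case by (auto simp: Q_def)
  next
    case (5 a)
    then show ?case by (auto simp: pair_extend_def insert_absorb split: prod.splits)
  qed
  also have "\<dots> = (\<Sum>s\<in>UNIV. \<Sum>p\<in>Q (fst s) (snd s). f (pair_extend n (fst s) (snd s) p))"
    by (rule sum.Sigma[symmetric]) (auto simp: fin)
  also have "\<dots> = (\<Sum>x\<in>UNIV. \<Sum>y\<in>UNIV. \<Sum>p\<in>Q x y. f (pair_extend n x y p))"
    by (simp add: sum.cartesian_product flip: UNIV_Times_UNIV) (simp add: case_prod_beta)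
  finally have "sum f (exc_pairs (Suc n) h) =
      (\<Sum>x\<in>UNIV. \<Sum>y\<in>UNIV. \<Sum>p\<in>Q x y. f (pair_extend n x y p))" .
  moreover have "Q False False = exc_pairs n h"
    by (auto simp: Q_iff exc_iff)
  moreover have "Q False True = exc_pairs n (Suc h)"
    by (auto simp: Q_iff exc_iff)
  moreover have "Q True True = (if h = 0 then {} else exc_pairs n h)"
    by (auto simp: Q_iff exc_iff)
  moreover have "Q True False = (if h = 0 then {} else exc_pairs n (h - 1))"
    by (auto simp: Q_iff exc_iff)
  ultimately show ?thesis by (auto simp: UNIV_bool algebra_simps)
qed

lemma pair_sum_extend:
  "(\<Sum>p\<in>exc_pairs n k. pair_weight r t q (Suc n) (pair_extend n x y p)) =
    (if \<not> x \<and> \<not> y \<and> k = 0 then r else 1) * t ^ of_bool y * q ^ (k - of_bool y) * pair_sum r t q n k"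
  unfolding pair_sum_def sum_distrib_left
  by (rule sum.cong) (auto simp: pair_weight_extend simp del: of_bool_eq)

lemma pair_sum_Suc_0: "pair_sum r t q (Suc n) 0 = r * pair_sum r t q n 0 + t * pair_sum r t q n 1"
  unfolding pair_sum_def[of _ _ _ "Suc n"] sum_exc_pairs_Suc pair_sum_extend by simp

text \<open>The level weight has two parts: \<open>q ^ Suc h\<close> when n + 1 is neither position
  nor value of an excedance, \<open>t * q ^ h\<close> when it is both.\<close>

lemma pair_sum_Suc_Suc: "pair_sum r t q (Suc n) (Suc h) =
    (q ^ Suc h + t * q ^ h) * pair_sum r t q n (Suc h) + q ^ h * pair_sum r t q n h +
    t * q ^ Suc h * pair_sum r t q n (Suc (Suc h))"
  unfolding pair_sum_def[of _ _ _ "Suc n"] sum_exc_pairs_Suc pair_sum_extend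
  by (simp add: algebra_simps)

lemma pair_sum_0: "pair_sum r t q 0 h = (if h = 0 then 1 else 0)"
proof -
  have "exc_pairs 0 h = (if h = 0 then {({}, {})} else {})" by (auto simp: exc_pairs_def)
  then show ?thesis by (simp add: pair_sum_def pair_weight_def pair_fix_def pair_gap_def)
qed

text \<open>
  The generating function of the pairs with \<open>h\<close> open excedances is guessed to be
  \<open>G \<cdot> (\<Prod>k<h. z q\<^sup>k J(q\<^sup>k z))\<close>; the recurrence has only one solution, so it suffices to check it.
\<close>

lemma pair_sum_eq_nth:
  fixes J G :: "'a::field fps"
  assumes J: "J * (1 - fps_const (q + t) * fps_X - fps_const (t * q ^ 2) * fps_X ^ 2 * fps_scale q J) = 1"
    and G: "G * (1 - fps_const r * fps_X - fps_const t * fps_X ^ 2 * J) = 1"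
  shows "pair_sum r t q n 0 = G $ n"
proof -
  define H where "H h = G * (\<Prod>k<h. fps_X * (fps_const (q ^ k) * fps_scale (q ^ k) J))" for h
  have H0: "H 0 = 1 + fps_X * (fps_const r * H 0 + fps_const t * H 1)"
    using G by (simp add: H_def fps_scale_by_one algebra_simps power2_eq_square)
  have HS: "H (Suc h) = fps_X * (fps_const (q ^ Suc h + t * q ^ h) * H (Suc h) +
      fps_const (q ^ h) * H h + fps_const (t * q ^ Suc h) * H (Suc (Suc h)))" for h
  proof -
    let ?c = "fps_const (q ^ h)" and ?K = "fps_scale (q ^ h) J" and ?L = "fps_scale (q ^ Suc h) J"
    \<comment> \<open>The equation for J at q^h z, multiplied by z q^h \<open>H h\<close>, is the
      required recurrence: J(q^(h+1) z) is absorbed into \<open>H (Suc (Suc h))\<close>.\<close>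
    have "fps_scale (q ^ h) (J * (1 - fps_const (q + t) * fps_X -
        fps_const (t * q ^ 2) * (fps_X * fps_X) * fps_scale q J)) = 1"
      using J by (simp add: power2_eq_square)
    then have K: "?K * (1 - (fps_const q + fps_const t) * (?c * fps_X) -
        fps_const t * fps_const q * fps_const q * ((?c * fps_X) * (?c * fps_X)) * ?L) = 1"
      by (simp only: fps_scale_hom fps_scale_one fps_scale_const fps_scale_X fps_scale_scale
          power_Suc2 power2_eq_square flip: fps_const_mult fps_const_add) (simp add: mult.assoc)
    have H1: "H (Suc h) = H h * (fps_X * (?c * ?K))" by (simp add: H_def mult.assoc)
    have H2: "H (Suc (Suc h)) = H (Suc h) * (fps_X * (fps_const q * ?c * ?L))"
      by (simp add: H_def mult.assoc)
    have c: "fps_const (q ^ Suc h + t * q ^ h) = fps_const q * ?c + fps_const t * ?c"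
      "fps_const (t * q ^ Suc h) = fps_const t * fps_const q * ?c"
      by (simp_all add: algebra_simps)
    show ?thesis unfolding c H2 using K H1 by algebra
  qed
  have "pair_sum r t q n h = H h $ n" for h
  proof (induction n arbitrary: h)
    case 0
    show ?case
    proof (cases h)
      case 0
      have "H 0 $ 0 = 1" by (subst H0) simp
      then show ?thesis by (simp add: pair_sum_0 0)
    next
      case (Suc k)
      have "H (Suc k) $ 0 = 0" by (subst HS) simp
      then show ?thesis by (simp add: pair_sum_0 Suc)
    qed
  next
    case (Suc n)
    show ?case
    proof (cases h)
      case 0
      have "H 0 $ Suc n = r * H 0 $ n + t * H 1 $ n" by (subst H0) simp
      then show ?thesis by (simp add: pair_sum_Suc_0 0 Suc.IH)
    next
      case (Suc k)
      have "H (Suc k) $ Suc n = (q ^ Suc k + t * q ^ k) * H (Suc k) $ n + q ^ k * H k $ n +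
         t * q ^ Suc k * H (Suc (Suc k)) $ n"
        by (subst HS) (simp only: fps_mult_left_const_nth fps_X_mult_nth fps_add_nth, simp)
      then show ?thesis by (simp only: pair_sum_Suc_Suc Suc Suc.IH)
    qed
  qed
  then show ?thesis by (simp add: H_def)
qed

text \<open>The even contraction: with L the tail from c_2, F = 1 / (1 - z L) and L = 1 + t z L F(q
  z), hence F = 1 / (1 - z - t z^2 J) for J = F(q z) L.\<close>

lemma pair_sum_eq_Cn: "pair_sum 1 t q n 0 = Cn n t q"
proof -
  let ?F = "cflim t q 1" and ?L = "cflim t q 2"
  let ?J = "fps_scale q ?F * ?L" and ?t = "fps_const t" and ?q = "fps_const q"
  have F: "?F = 1 + fps_X * (?F * ?L)"
    using cflim_eq[of t q 1] by (simp add: cfcoeff_1 numeral_2_eq_2)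
  have L: "?L = 1 + ?t * fps_X * (?L * fps_scale q ?F)"
    using cflim_eq[of t q 2] cflim_3[of t q]
    by (simp add: cfcoeff_2 numeral_2_eq_2 numeral_3_eq_3)
  have Fq: "fps_scale q ?F = 1 + ?q * fps_X * (fps_scale q ?F * fps_scale q ?L)"
    by (subst F) (simp add: fps_scale_add fps_scale_mult mult.assoc)
  have Lq: "fps_scale q ?L = 1 + ?t * (?q * fps_X) * (fps_scale q ?L * fps_scale q (fps_scale q ?F))"
    by (subst L) (simp add: fps_scale_add fps_scale_mult mult.assoc)
  \<comment> \<open>1 / J = (1 - t z F(q z)) (1 - q z L(q z)), whose second factor is 1 / F(q z). So
    1 / J = 1 - t z - q z L(q z), and the equation for L(q z) finishes.\<close>
  have J: "?J * (1 - (?q + ?t) * fps_X - ?t * ?q ^ 2 * fps_X ^ 2 * (fps_scale q (fps_scale q ?F) * fps_scale q ?L)) = 1"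
    using L Fq Lq by algebra
  have "?F * (1 - fps_X - ?t * fps_X ^ 2 * ?J) = 1"
    using F L by algebra
  then have "pair_sum 1 t q n 0 = ?F $ n"
    using J by (intro pair_sum_eq_nth) (simp_all add: fps_scale_mult flip: fps_const_mult)
  then show ?thesis by (simp add: Cn_eq_cflim)
qed

text \<open>The level weights vanish: at height 0 since r = 0, above it since q + t = 0. The
  equation for E is then the one for G = E with J = E(q z), and scaled by q it is the one for
  J.\<close>

lemma pair_sum_derangement: "pair_sum 0 (- q) q n 0 = carlitz_even_fps q $ n"
proof (rule pair_sum_eq_nth)
  let ?E = "carlitz_even_fps q"
  have E: "?E * (1 + fps_const q * fps_X ^ 2 * fps_scale q ?E) = 1"
    by (rule carlitz_even_functional_eq)
  then show "?E * (1 - fps_const 0 * fps_X - fps_const (- q) * fps_X ^ 2 * fps_scale q ?E) = 1"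
    by (simp flip: fps_const_neg)
  from E have "fps_scale q (?E * (1 + fps_const q * (fps_X * fps_X) * fps_scale q ?E)) = 1"
    by (simp add: power2_eq_square)
  then have "fps_scale q ?E * (1 + fps_const q * ((fps_const q * fps_X) * (fps_const q * fps_X)) *
      fps_scale q (fps_scale q ?E)) = 1"
    by (simp only: fps_scale_hom fps_scale_one fps_scale_const fps_scale_X)
  moreover have "fps_const (- q * q ^ 2) = - (fps_const q * (fps_const q * fps_const q))"
    by (simp add: power2_eq_square)
  ultimately show "fps_scale q ?E * (1 - fps_const (q + - q) * fps_X -
      fps_const (- q * q ^ 2) * fps_X ^ 2 * fps_scale q (fps_scale q ?E)) = 1"
    by (simp only: power2_eq_square) (simp only: mult.assoc mult.commute mult.left_commute
      fps_const_0_eq_0 mult_zero_left mult_zero_right diff_zero add.right_inverse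
      mult_minus_left mult_minus_right diff_minus_eq_add)
qed

section \<open>321-avoiding permutations\<close>

lemma strict_mono_on_rank:
  fixes f :: "'a::linorder \<Rightarrow> 'b::linorder"
  assumes "strict_mono_on A f" "a \<in> A"
  shows "card {y \<in> f ` A. y < f a} = card {x \<in> A. x < a}"
proof -
  have "{y \<in> f ` A. y < f a} = f ` {x \<in> A. x < a}"
    using assms by (auto simp: strict_mono_on_less)
  moreover have "inj_on f {x \<in> A. x < a}"
    using strict_mono_on_imp_inj_on[OF assms(1)] by (rule inj_on_subset) auto
  ultimately show ?thesis by (simp add: card_image)
qed

lemma card_less_inj:
  fixes a b :: "'a::linorder"
  assumes "finite B" "a \<in> B" "b \<in> B" "card {y \<in> B. y < a} = card {y \<in> B. y < b}"
  shows "a = b"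
proof (rule ccontr)
  assume "a \<noteq> b"
  moreover have False if "c < d" "c \<in> B" "card {y \<in> B. y < c} = card {y \<in> B. y < d}" for c d
  proof -
    have "{y \<in> B. y < c} \<subset> {y \<in> B. y < d}" using that by auto
    with assms(1) have "card {y \<in> B. y < c} < card {y \<in> B. y < d}"
      by (intro psubset_card_mono) auto
    with that show False by simp
  qed
  ultimately show False using assms by (metis linorder_neq_iff)
qed

lemma strict_mono_on_image_unique:
  fixes f g :: "'a::linorder \<Rightarrow> 'b::linorder"
  assumes "finite A" "strict_mono_on A f" "strict_mono_on A g" "f ` A = g ` A" "a \<in> A"
  shows "f a = g a"
proof (rule card_less_inj)
  show "card {y \<in> f ` A. y < f a} = card {y \<in> f ` A. y < g a}"
    using strict_mono_on_rank[of A f a] strict_mono_on_rank[of A g a] assms by simp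
qed (use assms in auto)

lemma ex_strict_mono_on_image_eq:
  fixes A B :: "nat set"
  assumes "finite A" "finite B" "card A = card B"
  obtains f where "strict_mono_on A f" "f ` A = B"
proof -
  obtain a where a: "bij_betw a {..<card A} A" "strict_mono_on {..<card A} a"
    using ex_bij_betw_strict_mono_card[OF assms(1)] .
  obtain b where b: "bij_betw b {..<card A} B" "strict_mono_on {..<card A} b"
    using ex_bij_betw_strict_mono_card[OF assms(2)] assms(3) by metis
  define a' where "a' = inv_into {..<card A} a"
  have a': "bij_betw a' A {..<card A}" unfolding a'_def by (rule bij_betw_inv_into[OF a(1)])
  have aa': "a (a' x) = x" "a' x \<in> {..<card A}" if "x \<in> A" for x
    using that bij_betw_apply[OF a' that] bij_betw_inv_into_right[OF a(1) that]
    by (simp_all add: a'_def)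
  show ?thesis
  proof
    show "strict_mono_on A (b \<circ> a')"
    proof (rule strict_mono_onI)
      fix x y assume "x \<in> A" "y \<in> A" "x < y"
      then have "a' x < a' y" using strict_mono_on_less[OF a(2), of "a' x" "a' y"] aa' by simp
      then show "(b \<circ> a') x < (b \<circ> a') y"
        using strict_mono_on_less[OF b(2), of "a' x" "a' y"] aa' \<open>x \<in> A\<close> \<open>y \<in> A\<close> by simp
    qed
    show "(b \<circ> a') ` A = B"
      unfolding image_comp[symmetric] using a' b(1) by (simp only: bij_betw_imp_surj_on)
  qed
qed

section \<open>Monotonicity on excedances and on the other positions\<close>

definition exc_set :: "nat \<Rightarrow> (nat \<Rightarrow> nat) \<Rightarrow> nat set" where
  "exc_set n \<pi> = {i \<in> {1..n}. \<pi> i > i}"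

lemma exc_eq_card: "exc n \<pi> = card (exc_set n \<pi>)"
  by (simp add: exc_def exc_set_def)

lemma finite_exc_set [simp]: "finite (exc_set n \<pi>)"
  by (simp add: exc_set_def)

lemma exc_setD: "i \<in> exc_set n \<pi> \<Longrightarrow> 1 \<le> i \<and> i \<le> n \<and> i < \<pi> i"
  by (simp add: exc_set_def)

lemma permutes_neq: "\<pi> permutes S \<Longrightarrow> i \<noteq> j \<Longrightarrow> \<pi> i \<noteq> \<pi> j"
  by (metis permutes_inverses(2))

lemma permutes_Icc_bounds:
  assumes "\<pi> permutes {1..n::nat}" "1 \<le> i" "i \<le> n"
  shows "1 \<le> \<pi> i" "\<pi> i \<le> n"
  using permutes_in_image[OF assms(1), of i] assms(2,3) by auto

lemma S321_permutes: "\<pi> \<in> S321 n \<Longrightarrow> \<pi> permutes {1..n}"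
  by (simp add: S321_def)

lemma S321_inj_on: "\<pi> \<in> S321 n \<Longrightarrow> inj_on \<pi> A"
  using S321_permutes permutes_inj_on by blast

lemma S321_no_321:
  assumes "\<pi> \<in> S321 n" "1 \<le> i" "i < j" "j < k" "k \<le> n" "\<pi> i > \<pi> j" "\<pi> j > \<pi> k"
  shows False
  using assms by (auto simp: S321_def avoids321_def)

text \<open>If \<open>\<pi> i > \<pi> j\<close>, no value below \<open>\<pi> j\<close> occurs after
  \<open>j\<close>. So \<open>\<pi> j - 1\<close> values, at least \<open>j\<close> many, would have
  to fit into the \<open>j - 2\<close> positions before \<open>j\<close> other than
  \<open>i\<close>.\<close>

lemma S321_less_of_exc:
  assumes \<pi>: "\<pi> \<in> S321 n" and ij: "1 \<le> i" "i < j" "j \<le> n" and j: "\<pi> j > j"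
  shows "\<pi> i < \<pi> j"
proof (rule ccontr)
  note perm = S321_permutes[OF \<pi>]
  assume "\<not> \<pi> i < \<pi> j"
  then have ij': "\<pi> i > \<pi> j" using permutes_neq[OF perm, of i j] ij by force
  have "{1..<\<pi> j} \<subseteq> \<pi> ` ({1..<j} - {i})"
  proof
    fix v assume v: "v \<in> {1..<\<pi> j}"
    have "\<pi> j \<le> n" using permutes_Icc_bounds[OF perm, of j] ij by simp
    with v have "v \<in> {1..n}" by simp
    then obtain k where k: "k \<in> {1..n}" "v = \<pi> k"
      using permutes_image[OF perm] by (metis imageE)
    have "k \<noteq> j" "k \<noteq> i" using k v ij' by auto
    moreover have "\<not> j < k" using S321_no_321[OF \<pi>, of i j k] ij ij' k v by auto
    ultimately show "v \<in> \<pi> ` ({1..<j} - {i})" using k by auto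
  qed
  then have "card {1..<\<pi> j} \<le> card ({1..<j} - {i})"
    using surj_card_le by (metis finite_Diff finite_atLeastLessThan)
  also have "\<dots> = j - 2" using ij by (simp add: card_Diff_singleton)
  finally show False using j ij by simp
qed

text \<open>Dually, if \<open>\<pi> i > \<pi> j\<close>, all positions before \<open>i\<close> carry
  values below \<open>\<pi> i\<close>, and so does \<open>j\<close>. These are \<open>i\<close>
  positions for only \<open>\<pi> i - 1 < i\<close> values.\<close>

lemma S321_less_of_nonexc:
  assumes \<pi>: "\<pi> \<in> S321 n" and ij: "1 \<le> i" "i < j" "j \<le> n" and i: "\<pi> i \<le> i"
  shows "\<pi> i < \<pi> j"
proof (rule ccontr)
  note perm = S321_permutes[OF \<pi>]
  assume "\<not> \<pi> i < \<pi> j"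
  then have ij': "\<pi> i > \<pi> j" using permutes_neq[OF perm, of i j] ij by force
  have "\<pi> k \<in> {1..<\<pi> i}" if k: "k \<in> insert j {1..<i}" for k
  proof (cases "k = j")
    case True
    then show ?thesis using ij' permutes_Icc_bounds(1)[OF perm, of j] ij by simp
  next
    case False
    then have "\<not> \<pi> i < \<pi> k" using S321_no_321[OF \<pi>, of k i j] k ij ij' by auto
    moreover have "\<pi> k \<noteq> \<pi> i" using permutes_neq[OF perm, of k i] k ij by auto
    moreover have "1 \<le> \<pi> k" using permutes_Icc_bounds(1)[OF perm, of k] k False ij by auto
    ultimately show ?thesis by auto
  qed
  then have "\<pi> ` insert j {1..<i} \<subseteq> {1..<\<pi> i}" by blast
  then have "card (insert j {1..<i}) \<le> card {1..<\<pi> i}"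
    using card_inj_on_le[OF S321_inj_on[OF \<pi>]] by blast
  then show False using ij i by simp
qed

lemma S321_strict_mono_exc:
  assumes "\<pi> \<in> S321 n"
  shows "strict_mono_on (exc_set n \<pi>) \<pi>"
  using S321_less_of_exc[OF assms] by (auto simp: strict_mono_on_def exc_set_def)

lemma S321_strict_mono_nonexc:
  assumes "\<pi> \<in> S321 n"
  shows "strict_mono_on ({1..n} - exc_set n \<pi>) \<pi>"
  using S321_less_of_nonexc[OF assms] by (auto simp: strict_mono_on_def exc_set_def)

section \<open>The bijection with excedance pairs\<close>

definition exc_pair :: "nat \<Rightarrow> (nat \<Rightarrow> nat) \<Rightarrow> nat set \<times> nat set" where
  "exc_pair n \<pi> = (exc_set n \<pi>, \<pi> ` exc_set n \<pi>)"

lemma exc_values_cut: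
  assumes "\<pi> \<in> S321 n"
  shows "\<pi> ` exc_set n \<pi> \<inter> {..i} = \<pi> ` {x \<in> exc_set n \<pi>. \<pi> x \<le> i}"
    and "{x \<in> exc_set n \<pi>. \<pi> x \<le> i} \<subseteq> exc_set n \<pi> \<inter> {..<i}"
    and "card (\<pi> ` exc_set n \<pi> \<inter> {..i}) = card {x \<in> exc_set n \<pi>. \<pi> x \<le> i}"
proof -
  show eq: "\<pi> ` exc_set n \<pi> \<inter> {..i} = \<pi> ` {x \<in> exc_set n \<pi>. \<pi> x \<le> i}" by auto
  show "{x \<in> exc_set n \<pi>. \<pi> x \<le> i} \<subseteq> exc_set n \<pi> \<inter> {..<i}" by (auto dest: exc_setD)
  show "card (\<pi> ` exc_set n \<pi> \<inter> {..i}) = card {x \<in> exc_set n \<pi>. \<pi> x \<le> i}"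
    unfolding eq by (rule card_image) (rule S321_inj_on[OF assms])
qed

lemma exc_pair_mem:
  assumes \<pi>: "\<pi> \<in> S321 n"
  shows "exc_pair n \<pi> \<in> exc_pairs n 0"
proof -
  have "exc_set n \<pi> \<subseteq> {1..n}" by (auto simp: exc_set_def)
  moreover have "\<pi> ` exc_set n \<pi> \<subseteq> {1..n}"
    using permutes_image[OF S321_permutes[OF \<pi>]] calculation by blast
  moreover have "card (\<pi> ` exc_set n \<pi>) = card (exc_set n \<pi>)"
    by (rule card_image) (rule S321_inj_on[OF \<pi>])
  moreover have "card (\<pi> ` exc_set n \<pi> \<inter> {..i}) \<le> card (exc_set n \<pi> \<inter> {..<i})" for i
    unfolding exc_values_cut(3)[OF \<pi>] by (rule card_mono[OF _ exc_values_cut(2)[OF \<pi>]]) simp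
  ultimately show ?thesis by (simp add: exc_pair_def exc_pairs_def)
qed

text \<open>The pair also fixes the complementary positions and values, and between finite sets
  there is only one increasing bijection.\<close>

lemma inj_on_exc_pair: "inj_on (exc_pair n) (S321 n)"
proof (rule inj_onI)
  fix \<pi> \<sigma> assume \<pi>: "\<pi> \<in> S321 n" and \<sigma>: "\<sigma> \<in> S321 n" and "exc_pair n \<pi> = exc_pair n \<sigma>"
  then have X: "exc_set n \<sigma> = exc_set n \<pi>" and Y: "\<pi> ` exc_set n \<pi> = \<sigma> ` exc_set n \<pi>"
    by (auto simp: exc_pair_def)
  have Y': "\<pi> ` ({1..n} - exc_set n \<pi>) = \<sigma> ` ({1..n} - exc_set n \<pi>)"
    using Y permutes_image[OF S321_permutes[OF \<pi>]] permutes_image[OF S321_permutes[OF \<sigma>]]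
      image_set_diff[OF permutes_inj[OF S321_permutes[OF \<pi>]]]
      image_set_diff[OF permutes_inj[OF S321_permutes[OF \<sigma>]]] by simp
  show "\<pi> = \<sigma>"
  proof
    fix i
    consider "i \<notin> {1..n}" | "i \<in> exc_set n \<pi>" | "i \<in> {1..n} - exc_set n \<pi>" by blast
    then show "\<pi> i = \<sigma> i"
    proof cases
      case 1
      then show ?thesis using S321_permutes[OF \<pi>] S321_permutes[OF \<sigma>] by (simp add: permutes_not_in)
    next
      case 2
      then show ?thesis
        using strict_mono_on_image_unique[OF _ S321_strict_mono_exc[OF \<pi>] _ Y]
          S321_strict_mono_exc[OF \<sigma>] by (simp add: X)
    next
      case 3
      then show ?thesis
        using strict_mono_on_image_unique[OF _ S321_strict_mono_nonexc[OF \<pi>] _ Y']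
          S321_strict_mono_nonexc[OF \<sigma>] by (simp add: X)
    qed
  qed
qed

text \<open>Glue the increasing bijections from \<open>X\<close> to \<open>Y\<close> and between the
  complements. The domination inequalities then make \<open>X\<close> exactly the set of
  excedances.\<close>

lemma exc_pair_surj:
  assumes "(X, Y) \<in> exc_pairs n 0"
  obtains \<pi> where "\<pi> \<in> S321 n" "exc_pair n \<pi> = (X, Y)"
proof -
  have X: "X \<subseteq> {1..n}" and Y: "Y \<subseteq> {1..n}" and card: "card X = card Y"
    and dom: "\<And>i. 1 \<le> i \<Longrightarrow> i \<le> n \<Longrightarrow> card (Y \<inter> {..i}) \<le> card (X \<inter> {..<i})"
    using assms by (auto simp: exc_pairs_def)
  have fin: "finite X" "finite Y" using X Y finite_subset by blast+
  let ?X = "{1..n} - X" and ?Y = "{1..n} - Y"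
  obtain f where f: "strict_mono_on X f" "f ` X = Y"
    using ex_strict_mono_on_image_eq[OF fin card] .
  have "card ?X = card ?Y" using X Y fin card by (simp add: card_Diff_subset)
  then obtain g where g: "strict_mono_on ?X g" "g ` ?X = ?Y"
    using ex_strict_mono_on_image_eq[of ?X ?Y] by auto
  define \<pi> where "\<pi> i = (if i \<in> X then f i else if i \<in> {1..n} then g i else i)" for i
  have \<pi>X: "\<pi> i = f i" if "i \<in> X" for i using that by (simp add: \<pi>_def)
  have \<pi>X': "\<pi> i = g i" if "i \<in> ?X" for i using that by (simp add: \<pi>_def)
  have "\<pi> ` X = f ` X" "\<pi> ` ?X = g ` ?X"
    by (intro image_cong[OF refl] \<pi>X \<pi>X'; assumption)+
  then have img: "\<pi> ` X = Y" "\<pi> ` ?X = ?Y" by (simp_all only: f(2) g(2))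
  have "\<pi> ` {1..n} = {1..n}" using image_Un[of \<pi> X ?X] by (simp only: img Diff_partition[OF X] Diff_partition[OF Y])
  then have "bij_betw \<pi> {1..n} {1..n}"
    by (simp add: bij_betw_def eq_card_imp_inj_on)
  then have perm: "\<pi> permutes {1..n}"
    by (rule bij_imp_permutes) (use X in \<open>auto simp: \<pi>_def\<close>)
  have av: "avoids321 n \<pi>"
    unfolding avoids321_def
  proof (clarify)
    fix i j k assume ijk: "1 \<le> i" "i < j" "j < k" "k \<le> n" "\<pi> j < \<pi> i" "\<pi> k < \<pi> j"
    have not_desc: False if "a < b" "\<pi> b < \<pi> a" "1 \<le> a" "b \<le> n" "a \<in> X \<longleftrightarrow> b \<in> X" for a b
    proof (cases "a \<in> X")
      case True
      then show ?thesis using that strict_mono_onD[OF f(1), of a b] \<pi>X by auto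
    next
      case False
      then have "a \<in> ?X" "b \<in> ?X" using that by auto
      then show ?thesis using that strict_mono_onD[OF g(1), of a b] \<pi>X'[of a] \<pi>X'[of b] by auto
    qed
    \<comment> \<open>Of three positions two lie on the same side of \<open>X\<close>, where \<pi>
      is increasing.\<close>
    show False using not_desc[of i j] not_desc[of j k] not_desc[of i k] ijk by auto
  qed
  \<comment> \<open>If \<open>f x \<le> x\<close>, the elements of \<open>X\<close> up to and
    including \<open>x\<close> all have images in \<open>Y\<close> at most \<open>x\<close>, one
    more than domination at \<open>x\<close> allows.\<close>
  have excX: "x < f x" if x: "x \<in> X" for x
  proof (rule ccontr)
    assume "\<not> x < f x"
    moreover have "f y \<in> Y \<and> f y \<le> f x" if "y \<in> X" "y \<le> x" for y
      using f(2) strict_mono_on_leD[OF f(1) that(1) x that(2)] that by auto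
    ultimately have "f ` {y \<in> X. y \<le> x} \<subseteq> Y \<inter> {..x}" by force
    then have "card {y \<in> X. y \<le> x} \<le> card (Y \<inter> {..x})"
      by (intro card_inj_on_le[of f] inj_on_subset[OF strict_mono_on_imp_inj_on[OF f(1)]])
        (use fin in auto)
    moreover have "{y \<in> X. y \<le> x} = insert x (X \<inter> {..<x})" using x by auto
    ultimately show False using dom[of x] x X fin by auto
  qed
  \<comment> \<open>If \<open>g x > x\<close>, every non-value up to \<open>x\<close> is the image
    of a non-position below \<open>x\<close>. Counting complements in \<open>{1..x}\<close> and
    \<open>{1..<x}\<close> contradicts domination at \<open>x\<close>.\<close>
  have nexcX: "g x \<le> x" if x: "x \<in> ?X" for x
  proof (rule ccontr)
    assume gx: "\<not> g x \<le> x"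
    have "?Y \<inter> {..x} \<subseteq> g ` (?X \<inter> {..<x})"
    proof
      fix v assume v: "v \<in> ?Y \<inter> {..x}"
      then obtain y where y: "y \<in> ?X" "v = g y" using g(2) by (metis IntD1 imageE)
      then have "g y < g x" using v gx by simp
      then have "y < x" using strict_mono_on_less[OF g(1) y(1) x] by simp
      then show "v \<in> g ` (?X \<inter> {..<x})" using y by blast
    qed
    then have "card (?Y \<inter> {..x}) \<le> card (?X \<inter> {..<x})" by (intro surj_card_le) auto
    moreover have "?Y \<inter> {..x} = {1..x} - (Y \<inter> {..x})" "?X \<inter> {..<x} = {1..<x} - (X \<inter> {..<x})"
      using x by auto
    moreover have "Y \<inter> {..x} \<subseteq> {1..x}" "X \<inter> {..<x} \<subseteq> {1..<x}" using X Y by auto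
    moreover have "card (X \<inter> {..<x}) \<le> card {1..<x}" using calculation by (intro card_mono) auto
    ultimately have "x - card (Y \<inter> {..x}) \<le> x - 1 - card (X \<inter> {..<x})"
      and "card (X \<inter> {..<x}) \<le> x - 1"
      using fin by (simp_all add: card_Diff_subset)
    moreover have "card (Y \<inter> {..x}) \<le> card (X \<inter> {..<x})" "1 \<le> x" using dom[of x] x by auto
    ultimately show False by linarith
  qed
  have "exc_set n \<pi> = X"
  proof (rule set_eqI)
    fix x
    consider "x \<in> X" | "x \<in> ?X" | "x \<notin> {1..n}" by blast
    then show "x \<in> exc_set n \<pi> \<longleftrightarrow> x \<in> X"
    proof cases
      case 1
      then show ?thesis using excX[OF 1] X by (auto simp: exc_set_def \<pi>X)
    next
      case 2
      then show ?thesis using nexcX[OF 2] \<pi>X'[OF 2] by (simp add: exc_set_def)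
    next
      case 3
      then show ?thesis using X by (auto simp: exc_set_def)
    qed
  qed
  then show ?thesis using that[of \<pi>] perm av img by (simp add: S321_def exc_pair_def)
qed

lemma bij_betw_exc_pair: "bij_betw (exc_pair n) (S321 n) (exc_pairs n 0)"
  unfolding bij_betw_def
proof
  show "exc_pair n ` S321 n = exc_pairs n 0"
  proof (intro subset_antisym subsetI)
    fix p assume "p \<in> exc_pairs n 0"
    then obtain \<pi> where "\<pi> \<in> S321 n" "exc_pair n \<pi> = p" using exc_pair_surj by (metis surj_pair)
    then show "p \<in> exc_pair n ` S321 n" by blast
  qed (auto intro: exc_pair_mem)
qed (rule inj_on_exc_pair)

section \<open>Inversions and fixed points in terms of the pair\<close>

text \<open>Every inversion starts at an excedance \<open>i\<close>. Of the
  \<open>\<pi> i - 1\<close> smaller values, \<open>i - 1\<close> are used up before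
  \<open>i\<close>, as all earlier values are smaller; the rest come later.\<close>

lemma S321_inv_count:
  assumes \<pi>: "\<pi> \<in> S321 n"
  shows "inv_count n \<pi> = (\<Sum>i\<in>exc_set n \<pi>. \<pi> i - i)"
proof -
  note perm = S321_permutes[OF \<pi>]
  let ?B = "\<lambda>i. {j \<in> {i<..n}. \<pi> j < \<pi> i}"
  have "{(i, j). i \<in> {1..n} \<and> j \<in> {1..n} \<and> i < j \<and> \<pi> i > \<pi> j} = Sigma (exc_set n \<pi>) ?B"
  proof -
    have "i < \<pi> i" if "1 \<le> i" "i < j" "j \<le> n" "\<pi> j < \<pi> i" for i j
      using S321_less_of_nonexc[OF \<pi> that(1-3)] that(4) by (meson less_asym not_less)
    then show ?thesis by (auto simp: exc_set_def)
  qed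
  moreover have "card (?B i) = \<pi> i - i" if i: "i \<in> exc_set n \<pi>" for i
  proof -
    have i': "1 \<le> i" "i \<le> n" "i < \<pi> i" using exc_setD[OF i] by auto
    have sub: "\<pi> ` {1..<i} \<subseteq> {1..<\<pi> i}"
    proof (rule image_subsetI)
      fix k assume "k \<in> {1..<i}"
      then show "\<pi> k \<in> {1..<\<pi> i}"
        using S321_less_of_exc[OF \<pi>, of k i] permutes_Icc_bounds(1)[OF perm, of k] i' by simp
    qed
    have "\<pi> ` ?B i = {1..<\<pi> i} - \<pi> ` {1..<i}"
    proof (intro subset_antisym subsetI)
      fix v assume "v \<in> \<pi> ` ?B i"
      then obtain j where "v = \<pi> j" "j \<in> ?B i" by blast
      then show "v \<in> {1..<\<pi> i} - \<pi> ` {1..<i}"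
        using permutes_Icc_bounds(1)[OF perm, of j] permutes_inj[OF perm] i'
        by (auto simp: inj_eq)
    next
      fix v assume v: "v \<in> {1..<\<pi> i} - \<pi> ` {1..<i}"
      then have "v \<in> {1..n}" using permutes_Icc_bounds(2)[OF perm, of i] i' by auto
      then obtain j where j: "j \<in> {1..n}" "v = \<pi> j" using permutes_image[OF perm] by (metis imageE)
      then have "j \<noteq> i" "\<not> j < i" using v by auto
      then show "v \<in> \<pi> ` ?B i" using j v by auto
    qed
    then have "card (?B i) = card ({1..<\<pi> i} - \<pi> ` {1..<i})"
      using card_image[OF S321_inj_on[OF \<pi>], of "?B i"] by simp
    also have "\<dots> = \<pi> i - i"
      using sub i' by (simp add: card_Diff_subset card_image[OF S321_inj_on[OF \<pi>]])
    finally show ?thesis .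
  qed
  ultimately show ?thesis by (simp add: inv_count_def)
qed

text \<open>Double counting of positions strictly between an excedance and its value:
  \<open>x\<close> passes over \<open>\<pi> x - x - 1\<close> of them. In particular
  \<open>inv_count n \<pi> - exc n \<pi>\<close> never truncates.\<close>

lemma S321_inv_count_eq_gap:
  assumes \<pi>: "\<pi> \<in> S321 n"
  shows "inv_count n \<pi> = exc n \<pi> + pair_gap n (exc_set n \<pi>) (\<pi> ` exc_set n \<pi>)"
proof -
  let ?X = "exc_set n \<pi>"
  have "card (?X \<inter> {..<i}) - card (\<pi> ` ?X \<inter> {..i}) = (\<Sum>x\<in>?X. of_bool (x < i \<and> i < \<pi> x))" for i
  proof -
    have "card (?X \<inter> {..<i}) - card (\<pi> ` ?X \<inter> {..i}) = card (?X \<inter> {..<i} - {x \<in> ?X. \<pi> x \<le> i})"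
      unfolding exc_values_cut(3)[OF \<pi>]
      by (rule card_Diff_subset[OF _ exc_values_cut(2)[OF \<pi>], symmetric]) simp
    also have "?X \<inter> {..<i} - {x \<in> ?X. \<pi> x \<le> i} = {x \<in> ?X. x < i \<and> i < \<pi> x}" by auto
    finally show ?thesis by (simp add: Int_def)
  qed
  then have "pair_gap n ?X (\<pi> ` ?X) = (\<Sum>i=1..n. \<Sum>x\<in>?X. of_bool (x < i \<and> i < \<pi> x))"
    by (simp add: pair_gap_def)
  also have "\<dots> = (\<Sum>x\<in>?X. \<Sum>i=1..n. of_bool (x < i \<and> i < \<pi> x))" by (rule sum.swap)
  also have "\<dots> = (\<Sum>x\<in>?X. \<pi> x - x - 1)"
  proof (rule sum.cong[OF refl])
    fix x assume "x \<in> ?X"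
    then have "{i \<in> {1..n}. x < i \<and> i < \<pi> x} = {x<..<\<pi> x}"
      using exc_setD[of x n \<pi>] permutes_Icc_bounds(2)[OF S321_permutes[OF \<pi>], of x] by auto
    then show "(\<Sum>i=1..n. of_bool (x < i \<and> i < \<pi> x)) = \<pi> x - x - 1"
      by (simp add: Int_def)
  qed
  finally have "exc n \<pi> + pair_gap n ?X (\<pi> ` ?X) = (\<Sum>x\<in>?X. 1 + (\<pi> x - x - 1))"
    by (simp only: sum.distrib exc_eq_card card_eq_sum)
  also have "\<dots> = (\<Sum>x\<in>?X. \<pi> x - x)"
    by (rule sum.cong) (auto dest: exc_setD)
  finally show ?thesis using S321_inv_count[OF \<pi>] by simp
qed

text \<open>A fixed point \<open>i\<close> has only larger values after it, so \<pi> preserves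
  \<open>{1..<i}\<close> and no excedance is open at \<open>i\<close>. Conversely, equal counts give
  \<open>i\<close> the same rank among non-excedance positions and values, where \<pi> is
  increasing.\<close>

lemma S321_fixed_points:
  assumes \<pi>: "\<pi> \<in> S321 n"
  shows "pair_fix n (exc_set n \<pi>) (\<pi> ` exc_set n \<pi>) = {i \<in> {1..n}. \<pi> i = i}"
proof -
  note perm = S321_permutes[OF \<pi>]
  let ?X = "exc_set n \<pi>"
  let ?Y = "\<pi> ` ?X"
  have "i \<notin> ?X \<and> i \<notin> ?Y \<and> card (?X \<inter> {..<i}) = card (?Y \<inter> {..<i}) \<longleftrightarrow> \<pi> i = i"
    if i: "1 \<le> i" "i \<le> n" for i
  proof
    assume fixed: "\<pi> i = i"
    then have "i \<notin> ?X" by (simp add: exc_set_def)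
    moreover have "i \<notin> ?Y"
      using permutes_neq[OF perm, of i] fixed by (metis calculation imageE)
    moreover have initial: "\<pi> ` {1..<i} = {1..<i}"
    proof (rule card_seteq[symmetric])
      show "{1..<i} \<subseteq> \<pi> ` {1..<i}"
      proof
        fix v assume v: "v \<in> {1..<i}"
        with i have "v \<in> {1..n}" by simp
        then obtain k where k: "k \<in> {1..n}" "v = \<pi> k" using permutes_image[OF perm] by (metis imageE)
        then have "k \<noteq> i" "\<not> i < k"
          using S321_less_of_nonexc[OF \<pi>, of i k] v i fixed by auto
        then show "v \<in> \<pi> ` {1..<i}" using k by auto
      qed
      show "card (\<pi> ` {1..<i}) \<le> card {1..<i}" by (rule card_image_le) simp
    qed simp
    moreover have "?Y \<inter> {..<i} = \<pi> ` (?X \<inter> {..<i})"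
    proof -
      have "\<pi> x < i \<longleftrightarrow> x < i" if "x \<in> ?X" for x
      proof
        assume "\<pi> x < i"
        then show "x < i" using exc_setD[OF that] by simp
      next
        assume "x < i"
        then have "\<pi> x \<in> \<pi> ` {1..<i}" using exc_setD[OF that] by simp
        then show "\<pi> x < i" unfolding initial by simp
      qed
      then show ?thesis by auto
    qed
    ultimately show "i \<notin> ?X \<and> i \<notin> ?Y \<and> card (?X \<inter> {..<i}) = card (?Y \<inter> {..<i})"
      by (simp add: card_image[OF S321_inj_on[OF \<pi>]])
  next
    assume *: "i \<notin> ?X \<and> i \<notin> ?Y \<and> card (?X \<inter> {..<i}) = card (?Y \<inter> {..<i})"
    let ?X' = "{1..n} - ?X" and ?Y' = "{1..n} - ?Y"
    have X: "?X \<subseteq> {1..n}" and Y: "?Y \<subseteq> {1..n}"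
      using exc_pair_mem[OF \<pi>] by (simp_all add: exc_pairs_def exc_pair_def)
    have img: "\<pi> ` ?X' = ?Y'"
      using image_set_diff[OF permutes_inj[OF perm]] permutes_image[OF perm] by simp
    have iX: "i \<in> ?X'" using * i by simp
    have card: "card {x \<in> {1..n} - A. x < i} = (i - 1) - card (A \<inter> {..<i})" if "A \<subseteq> {1..n}" for A
    proof -
      have "{x \<in> {1..n} - A. x < i} = {1..<i} - A \<inter> {..<i}" using i by auto
      moreover have "A \<inter> {..<i} \<subseteq> {1..<i}" using that by auto
      ultimately show ?thesis by (simp add: card_Diff_subset finite_subset)
    qed
    show "\<pi> i = i"
    proof (rule card_less_inj)
      show "card {y \<in> ?Y'. y < \<pi> i} = card {y \<in> ?Y'. y < i}"
        using strict_mono_on_rank[OF S321_strict_mono_nonexc[OF \<pi>] iX] *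
        by (simp only: img card[OF X] card[OF Y])
      show "\<pi> i \<in> ?Y'" using img iX by blast
      show "i \<in> ?Y'" using * i by simp
    qed simp
  qed
  then show ?thesis by (auto simp: pair_fix_def)
qed


section \<open>From pairs back to permutations\<close>

lemma sum_S321_eq_pair_sum:
  fixes r t q :: "'a::comm_ring_1"
  shows "(\<Sum>\<pi>\<in>S321 n. r ^ card {i \<in> {1..n}. \<pi> i = i} * t ^ exc n \<pi> * q ^ (inv_count n \<pi> - exc n \<pi>)) =
    pair_sum r t q n 0"
proof -
  have "pair_sum r t q n 0 = (\<Sum>\<pi>\<in>S321 n. pair_weight r t q n (exc_pair n \<pi>))"
    unfolding pair_sum_def by (rule sum.reindex_bij_betw[OF bij_betw_exc_pair, symmetric])
  also have "\<dots> = (\<Sum>\<pi>\<in>S321 n. r ^ card {i \<in> {1..n}. \<pi> i = i} * t ^ exc n \<pi> *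
      q ^ (inv_count n \<pi> - exc n \<pi>))"
    by (rule sum.cong) (simp_all add: pair_weight_def exc_pair_def S321_fixed_points
      S321_inv_count_eq_gap card_image[OF S321_inj_on] exc_eq_card)
  finally show ?thesis ..
qed

lemma finite_S321: "finite (S321 n)"
  by (rule finite_subset[OF _ finite_permutations[of "{1..n}"]]) (auto simp: S321_def)

theorem theorem1p4:
  fixes q :: "'a::field" and n :: nat
  assumes "n \<ge> 1"
  shows "Cn n (-1) q = (\<Sum>\<pi>\<in>S321 n. (-1) ^ exc n \<pi> * q ^ (inv_count n \<pi> - exc n \<pi>))
       \<and> (\<Sum>\<pi>\<in>S321 n. (-1) ^ exc n \<pi> * q ^ (inv_count n \<pi> - exc n \<pi>)) =
           (if even n then 0 else (- q) ^ ((n - 1) div 2) * carlitzC ((n - 1) div 2) (q ^ 2))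
       \<and> (\<Sum>\<pi>\<in>D321 n. (-1) ^ exc n \<pi> * q ^ inv_count n \<pi>) =
           (if even n then (- q) ^ (n div 2) * carlitzC (n div 2) (q ^ 2) else 0)"
proof (intro conjI)
  show S: "Cn n (-1) q = (\<Sum>\<pi>\<in>S321 n. (-1) ^ exc n \<pi> * q ^ (inv_count n \<pi> - exc n \<pi>))"
    using sum_S321_eq_pair_sum[where n = n and r = 1 and t = "-1" and q = q] by (simp add: pair_sum_eq_Cn)
  obtain m where m: "n = Suc m" using assms by (cases n) auto
  \<comment> \<open>The factor z in 1 + z E shifts the index to n - 1, so the zeros fall on even
    n.\<close>
  have "Cn n (-1) q = carlitz_even_fps q $ m"
    unfolding Cn_eq_cflim cflim_minus_one m by simp
  then show "(\<Sum>\<pi>\<in>S321 n. (-1) ^ exc n \<pi> * q ^ (inv_count n \<pi> - exc n \<pi>)) =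
      (if even n then 0 else (- q) ^ ((n - 1) div 2) * carlitzC ((n - 1) div 2) (q ^ 2))"
    unfolding S[symmetric] by (simp add: carlitz_even_fps_def m)
  \<comment> \<open>The power of 0 is 1 on derangements and 0 otherwise; the missing factor q^exc is
    moved into t = -q.\<close>
  have "(\<Sum>\<pi>\<in>D321 n. (-1) ^ exc n \<pi> * q ^ inv_count n \<pi>) =
      (\<Sum>\<pi>\<in>S321 n. 0 ^ card {i \<in> {1..n}. \<pi> i = i} * (- q) ^ exc n \<pi> *
        q ^ (inv_count n \<pi> - exc n \<pi>))"
  proof (rule sum.mono_neutral_cong_left[OF finite_S321])
    show "D321 n \<subseteq> S321 n" by (auto simp: D321_def)
    show "\<forall>\<pi>\<in>S321 n - D321 n. 0 ^ card {i \<in> {1..n}. \<pi> i = i} * (- q) ^ exc n \<pi> *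
        q ^ (inv_count n \<pi> - exc n \<pi>) = 0"
      by (auto simp: D321_def power_0_left)
    fix \<pi> assume "\<pi> \<in> D321 n"
    then have \<pi>: "\<pi> \<in> S321 n" and fp: "{i \<in> {1..n}. \<pi> i = i} = {}" by (auto simp: D321_def)
    have "(- q) ^ exc n \<pi> = (-1) ^ exc n \<pi> * q ^ exc n \<pi>" by (rule power_minus)
    then show "(-1) ^ exc n \<pi> * q ^ inv_count n \<pi> = 0 ^ card {i \<in> {1..n}. \<pi> i = i} *
        (- q) ^ exc n \<pi> * q ^ (inv_count n \<pi> - exc n \<pi>)"
      unfolding fp by (simp add: S321_inv_count_eq_gap[OF \<pi>] power_add)
  qed
  also have "\<dots> = (if even n then (- q) ^ (n div 2) * carlitzC (n div 2) (q ^ 2) else 0)"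
    unfolding sum_S321_eq_pair_sum pair_sum_derangement by (simp add: carlitz_even_fps_def)
  finally show "(\<Sum>\<pi>\<in>D321 n. (-1) ^ exc n \<pi> * q ^ inv_count n \<pi>) =
      (if even n then (- q) ^ (n div 2) * carlitzC (n div 2) (q ^ 2) else 0)" .
qed

end
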